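(* Consider the nominal system in $\mathbb R^n$, $\dot{\bar p}=\bar v$, $\dot{\bar v}=\bar a$, with the blended control law $$\bar a=\Theta\bar a_\Phi+(1-\Theta)\bar a_\Psi,\qquad \Theta=\min\{1,\max\{0,\,k_E(\mathbf D^h_{\mathcal O}(\bar p,t))^\top(\bar a_\Phi-\bar a_\Psi)\}\},\quad k_E>0,$$ where $\bar a_\Phi$ (path-following law), $\bar a_\Psi$ (avoidance law) and $\mathbf D^h_{\mathcal O}$ are defined in the context. Assume the initial conditions $B^{h,\bar\lambda}(\bar p(0),0)\ge0$ and $\dot B^{h,\bar\lambda}(\bar p(0),\bar v(0),0)\ge r_1B^{h,\bar\lambda}(\bar p(0),0)$. Then the system is kept at least a distance $\bar\lambda$ from the obstacles: $\min_{i=1,\dots,N}\|\bar p(t)-o_i(t)\|\ge\bar\lambda$ for all $t\ge0$.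
   Context: **Path-following law.** $\mathcal C(t)\subset\mathbb R^n$ is a time-varying curve with parametric representation $c(s,t)$. For $(\bar p,t)$: $s_*(\bar p,t)=\arg\min_s\|\bar p-c(s,t)\|$ (assumed a singleton on the domain considered), $c_*(\bar p,t)=c(s_*(\bar p,t),t)$, $D_{\mathcal C}(\bar p,t)=\bar p-c_*(\bar p,t)$, $T_{\mathcal C}(\bar p,t)=\partial c/\partial s|_{s=s_*}$. With $k_G>0$, $G=\frac{2}{\pi}\tan^{-1}(k_G\|D_{\mathcal C}\|)$, $H=\pm\sqrt{1-G^2}$ (a fixed choice of sign), $\Phi_S=-G\frac{D_{\mathcal C}}{\|D_{\mathcal C}\|}+H\frac{T_{\mathcal C}}{\|T_{\mathcal C}\|}$ (first term read as $0$ when $D_{\mathcal C}=0$), $\Phi_T=-\Pi_T\frac{\partial D_{\mathcal C}}{\partial t}$ with $\Pi_T$ the orthogonal projector onto the orthogonal complement of $T_{\mathcal C}$; with reference speed $v_r>0$ and $\|\Phi_T\|<v_r$, $\eta=-\Phi_S\cdot\Phi_T+\sqrt{(\Phi_S\cdot\Phi_T)^2+v_r^2-\|\Phi_T\|^2}$ and $\Phi=\eta\Phi_S+\Phi_T$. Then $\bar a_\Phi=-k_pD_{\mathcal C}-k_v(\bar v-\Phi)+\dot\Phi$ with $k_p,k_v>0$, where $\dot\Phi$ is the total time derivative of $\Phi(\bar p(t),t)$ along the trajectory. **Obstacles.** The obstacle set $\mathcal O(t)$ consists of $N$ moving points $o_1(t),\dots,o_N(t)\in\mathbb R^n$, differentiable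 in $t$ as many times as required by the formulas below; $\bar\lambda>0$ is a safety threshold. With smoothing parameter $h>0$, $$D^h_{\mathcal O}(\bar p,t)=\Big(\sum_{i=1}^N\big(\tfrac12\|\bar p-o_i(t)\|^2\big)^{-1/h}\Big)^{-h},\qquad B^{h,\bar\lambda}(\bar p,t)=D^h_{\mathcal O}(\bar p,t)-\tfrac{\bar\lambda^2}{2}.$$ Write $\mathbf D^h_{\mathcal O}=\partial D^h_{\mathcal O}/\partial\bar p$ (gradient vector) and $T_{\mathcal O}=M\mathbf D^h_{\mathcal O}$, where $M$ is a pre-defined skew-symmetric matrix (so $T_{\mathcal O}\perp\mathbf D^h_{\mathcal O}$), chosen so that $T_{\mathcal O}^\top\bar v>0$. Let $k_2>0$, $k_1>2\sqrt{k_2}$, and let $r_1$ be the smallest (negative real) root of $r^2+k_1r+k_2=0$. Let $\dot B^{h,\bar\lambda}(\bar p,\bar v,t)=(\mathbf D^h_{\mathcal O})^\top\bar v+\partial D^h_{\mathcal O}/\partial t$ and $$F_1=\bar v^\top\frac{\partial\mathbf D^h_{\mathcal O}}{\partial\bar p}\bar v+2\Big(\frac{\partial\mathbf D^h_{\mathcal O}}{\partial t}\Big)^\top\bar v+\frac{\partial^2D^h_{\mathcal O}}{\partial t^2}+k_1\dot B^{h,\bar\lambda}+k_2B^{h,\bar\lambda},\qquad F_2=\bar v^\top\frac{\partial T_{\mathcal O}}{\partial\bar p}\bar v+\Big(\frac{\partial T_{\mathcal O}}{\partial t}\Big)^\top\bar v.$$ **Avoidance law.** With $\varepsilon>0$,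 $$\bar a_\Psi=\frac{-F_1}{\|\mathbf D^h_{\mathcal O}\|^2}\mathbf D^h_{\mathcal O}+\Big(\frac{-F_2}{\|T_{\mathcal O}\|^2}+\varepsilon\Big)T_{\mathcal O}.$$ Trajectories are understood to be ones along which all these expressions are well defined. *)

theory Defs
  imports "HOL-Analysis.Analysis"
begin

text \<open>Time runs over \<open>[0,\<infinity>)\<close>, so derivatives with respect to time are one-sided at \<open>0\<close>.
  For a trajectory \<open>p\<close>, a partial time derivative is \<open>ddt (\<lambda>\<tau>. f x \<tau>) t\<close> with \<open>x\<close> frozen,
  a total one is \<open>ddt (\<lambda>\<tau>. f (p \<tau>) \<tau>) t\<close>.\<close>

abbreviation ddt :: "(real \<Rightarrow> 'a::real_normed_vector) \<Rightarrow> real \<Rightarrow> 'a" where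
  "ddt f t \<equiv> vector_derivative f (at t within {0..})"

definition gradient :: "('a::real_inner \<Rightarrow> real) \<Rightarrow> 'a \<Rightarrow> 'a" where
  "gradient f x = (THE d. GDERIV f x :> d)"

lemma gradient_eqI:
  assumes "GDERIV f x :> d"
  shows "gradient f x = d"
  unfolding gradient_def
proof (rule the_equality)
  show "GDERIV f x :> d" by (fact assms)
next
  fix e assume "GDERIV f x :> e"
  with assms have "(\<lambda>h. h \<bullet> e) = (\<lambda>h. h \<bullet> d)"
    unfolding gderiv_def by (rule has_derivative_unique[rotated])
  then have "h \<bullet> (e - d) = 0" for h
    by (metis inner_diff_right right_minus_eq)
  then show "e = d"
    by (metis inner_eq_zero_iff right_minus_eq)
qed

definition proj_perp :: "'a::real_inner \<Rightarrow> 'a \<Rightarrow> 'a" where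
  "proj_perp T x = x - ((x \<bullet> T) / (T \<bullet> T)) *\<^sub>R T"

lemma proj_perp:
  "orthogonal T (proj_perp T x)" "x - proj_perp T x \<in> span {T}"
  by (auto simp: proj_perp_def orthogonal_def inner_diff_right inner_commute span_breakdown_eq)

text \<open>\<open>c s t\<close> is the point of the curve with parameter \<open>s \<in> S\<close> at time \<open>t\<close>;
  \<open>S = UNIV\<close> is allowed, and a half-open \<open>S\<close> makes it possible to parametrize closed curves
  injectively.\<close>

definition s_star ::
  "real set \<Rightarrow> (real \<Rightarrow> real \<Rightarrow> real^'n) \<Rightarrow> real^'n \<Rightarrow> real \<Rightarrow> real" where
  "s_star S c x t = arg_min (\<lambda>s. norm (x - c s t)) (\<lambda>s. s \<in> S)"

definition c_star ::
  "real set \<Rightarrow> (real \<Rightarrow> real \<Rightarrow> real^'n) \<Rightarrow> real^'n \<Rightarrow> real \<Rightarrow> real^'n" where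
  "c_star S c x t = c (s_star S c x t) t"

definition D_C ::
  "real set \<Rightarrow> (real \<Rightarrow> real \<Rightarrow> real^'n) \<Rightarrow> real^'n \<Rightarrow> real \<Rightarrow> real^'n" where
  "D_C S c x t = x - c_star S c x t"

definition T_C ::
  "real set \<Rightarrow> (real \<Rightarrow> real \<Rightarrow> real^'n) \<Rightarrow> real^'n \<Rightarrow> real \<Rightarrow> real^'n" where
  "T_C S c x t = vector_derivative (\<lambda>s. c s t) (at (s_star S c x t) within S)"

definition G_gain :: "real \<Rightarrow> real^'n \<Rightarrow> real" where
  "G_gain k_G d = 2 / pi * arctan (k_G * norm d)"

text \<open>\<open>\<sigma> \<in> {1, -1}\<close> is the sign of \<open>H\<close>. The first summand vanishes when \<open>D_C = 0\<close>.\<close>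

definition Phi_S ::
  "real set \<Rightarrow> (real \<Rightarrow> real \<Rightarrow> real^'n) \<Rightarrow> real \<Rightarrow> real \<Rightarrow> real^'n \<Rightarrow> real \<Rightarrow> real^'n" where
  "Phi_S S c k_G \<sigma> x t =
     (let D = D_C S c x t; T = T_C S c x t; G = G_gain k_G D; H = \<sigma> * sqrt (1 - G\<^sup>2)
      in - (G *\<^sub>R (D /\<^sub>R norm D)) + H *\<^sub>R (T /\<^sub>R norm T))"

definition Phi_T ::
  "real set \<Rightarrow> (real \<Rightarrow> real \<Rightarrow> real^'n) \<Rightarrow> real^'n \<Rightarrow> real \<Rightarrow> real^'n" where
  "Phi_T S c x t = - proj_perp (T_C S c x t) (ddt (\<lambda>\<tau>. D_C S c x \<tau>) t)"

definition Phi ::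
  "real set \<Rightarrow> (real \<Rightarrow> real \<Rightarrow> real^'n) \<Rightarrow> real \<Rightarrow> real \<Rightarrow> real \<Rightarrow> real^'n \<Rightarrow> real \<Rightarrow> real^'n" where
  "Phi S c k_G \<sigma> v_r x t =
     (let f\<^sub>S = Phi_S S c k_G \<sigma> x t; f\<^sub>T = Phi_T S c x t;
          \<eta> = - (f\<^sub>S \<bullet> f\<^sub>T) + sqrt ((f\<^sub>S \<bullet> f\<^sub>T)\<^sup>2 + v_r\<^sup>2 - (norm f\<^sub>T)\<^sup>2)
      in \<eta> *\<^sub>R f\<^sub>S + f\<^sub>T)"

definition a_Phi ::
  "real set \<Rightarrow> (real \<Rightarrow> real \<Rightarrow> real^'n) \<Rightarrow> real \<Rightarrow> real \<Rightarrow> real \<Rightarrow> real \<Rightarrow> real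
    \<Rightarrow> (real \<Rightarrow> real^'n) \<Rightarrow> (real \<Rightarrow> real^'n) \<Rightarrow> real \<Rightarrow> real^'n" where
  "a_Phi S c k_G \<sigma> v_r k_p k_v p v t =
     - (k_p *\<^sub>R D_C S c (p t) t)
     - k_v *\<^sub>R (v t - Phi S c k_G \<sigma> v_r (p t) t)
     + ddt (\<lambda>\<tau>. Phi S c k_G \<sigma> v_r (p \<tau>) \<tau>) t"

text \<open>\<open>ob i t\<close>, for \<open>i \<in> {1..N}\<close>, is the position of obstacle \<open>i\<close> at time \<open>t\<close>.
  \<open>D_O\<close> has its intended meaning only if \<open>x \<noteq> ob i t\<close> for all \<open>i\<close>,
  since \<open>0 powr a = 0\<close>.\<close>

definition D_O ::
  "nat \<Rightarrow> (nat \<Rightarrow> real \<Rightarrow> real^'n) \<Rightarrow> real \<Rightarrow> real^'n \<Rightarrow> real \<Rightarrow> real" where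
  "D_O N ob h x t = (\<Sum>i=1..N. ((norm (x - ob i t))\<^sup>2 / 2) powr (- 1 / h)) powr (- h)"

definition B_O ::
  "nat \<Rightarrow> (nat \<Rightarrow> real \<Rightarrow> real^'n) \<Rightarrow> real \<Rightarrow> real \<Rightarrow> real^'n \<Rightarrow> real \<Rightarrow> real" where
  "B_O N ob h lam x t = D_O N ob h x t - lam\<^sup>2 / 2"

definition grad_D_O ::
  "nat \<Rightarrow> (nat \<Rightarrow> real \<Rightarrow> real^'n) \<Rightarrow> real \<Rightarrow> real^'n \<Rightarrow> real \<Rightarrow> real^'n" where
  "grad_D_O N ob h x t = gradient (\<lambda>y. D_O N ob h y t) x"

definition T_O ::
  "nat \<Rightarrow> (nat \<Rightarrow> real \<Rightarrow> real^'n) \<Rightarrow> real \<Rightarrow> real^'n^'n \<Rightarrow> real^'n \<Rightarrow> real \<Rightarrow> real^'n" where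
  "T_O N ob h M x t = M *v grad_D_O N ob h x t"

text \<open>The threshold enters \<open>B_O\<close> as an additive constant, hence it does not occur in \<open>B_dot\<close>.\<close>

definition B_dot ::
  "nat \<Rightarrow> (nat \<Rightarrow> real \<Rightarrow> real^'n) \<Rightarrow> real \<Rightarrow> real^'n \<Rightarrow> real^'n \<Rightarrow> real \<Rightarrow> real" where
  "B_dot N ob h x w t = grad_D_O N ob h x t \<bullet> w + ddt (\<lambda>\<tau>. D_O N ob h x \<tau>) t"

definition F1 ::
  "nat \<Rightarrow> (nat \<Rightarrow> real \<Rightarrow> real^'n) \<Rightarrow> real \<Rightarrow> real \<Rightarrow> real \<Rightarrow> real
    \<Rightarrow> real^'n \<Rightarrow> real^'n \<Rightarrow> real \<Rightarrow> real" where
  "F1 N ob h lam k1 k2 x w t =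
     w \<bullet> (jacobian (\<lambda>y. grad_D_O N ob h y t) (at x) *v w)
     + 2 * (ddt (\<lambda>\<tau>. grad_D_O N ob h x \<tau>) t \<bullet> w)
     + ddt (\<lambda>\<tau>. ddt (\<lambda>\<tau>'. D_O N ob h x \<tau>') \<tau>) t
     + k1 * B_dot N ob h x w t + k2 * B_O N ob h lam x t"

definition F2 ::
  "nat \<Rightarrow> (nat \<Rightarrow> real \<Rightarrow> real^'n) \<Rightarrow> real \<Rightarrow> real^'n^'n
    \<Rightarrow> real^'n \<Rightarrow> real^'n \<Rightarrow> real \<Rightarrow> real" where
  "F2 N ob h M x w t =
     w \<bullet> (jacobian (\<lambda>y. T_O N ob h M y t) (at x) *v w)
     + ddt (\<lambda>\<tau>. T_O N ob h M x \<tau>) t \<bullet> w"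

definition a_Psi ::
  "nat \<Rightarrow> (nat \<Rightarrow> real \<Rightarrow> real^'n) \<Rightarrow> real \<Rightarrow> real \<Rightarrow> real \<Rightarrow> real \<Rightarrow> real^'n^'n \<Rightarrow> real
    \<Rightarrow> real^'n \<Rightarrow> real^'n \<Rightarrow> real \<Rightarrow> real^'n" where
  "a_Psi N ob h lam k1 k2 M \<epsilon> x w t =
     (- F1 N ob h lam k1 k2 x w t / (norm (grad_D_O N ob h x t))\<^sup>2) *\<^sub>R grad_D_O N ob h x t
     + (- F2 N ob h M x w t / (norm (T_O N ob h M x t))\<^sup>2 + \<epsilon>) *\<^sub>R T_O N ob h M x t"

definition Theta :: "real \<Rightarrow> real^'n \<Rightarrow> real^'n \<Rightarrow> real^'n \<Rightarrow> real" where
  "Theta k_E g a b = min 1 (max 0 (k_E * (g \<bullet> (a - b))))"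

end

theory Submission
  imports Defs
begin

text \<open>Along a trajectory, \<open>B'' + k1 B' + k2 B = F1 + grad D \<bullet> a\<close>. Since the gradient is orthogonal to
  \<open>T_O\<close>, its inner product with \<open>a_Psi\<close> is \<open>- F1\<close>, so that the right-hand side reduces to
  \<open>\<Theta> (grad D \<bullet> (a_Phi - a_Psi))\<close>, which is nonnegative by the choice of \<open>\<Theta>\<close>. Factoring
  \<open>r\<^sup>2 + k1 r + k2\<close> and applying the integrating-factor argument twice, first to \<open>B' - r1 B\<close> and
  then to \<open>B\<close>, gives \<open>B \<ge> 0\<close>, and \<open>D_O\<close> is at most each single \<open>(norm (p - ob i))\<^sup>2 / 2\<close>.\<close>

section \<open>Smooth minimum of squared distances and its formal derivatives\<close>

definition half_sq :: "'a::real_inner \<Rightarrow> real" where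
  "half_sq u = (norm u)\<^sup>2 / 2"

definition power_sum :: "'i set \<Rightarrow> real \<Rightarrow> ('i \<Rightarrow> 'a::real_inner) \<Rightarrow> real" where
  "power_sum A h U = (\<Sum>i\<in>A. half_sq (U i) powr (- 1 / h))"

text \<open>The vectors \<open>U i\<close> stand for the differences \<open>x - ob i t\<close>. With
  these as the variable, motion of the point and motion of the obstacles are both just variations of
  \<open>U\<close>.\<close>

definition soft_dist :: "'i set \<Rightarrow> real \<Rightarrow> ('i \<Rightarrow> 'a::real_inner) \<Rightarrow> real" where
  "soft_dist A h U = power_sum A h U powr (- h)"

text \<open>For finite \<open>A\<close> and nonzero \<open>U i\<close>, multiplying by
  \<open>- 1 / h\<close> gives the derivative of \<open>power_sum\<close> at \<open>U\<close> in the
  direction \<open>X\<close>.\<close>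

definition weighted_sum :: "'i set \<Rightarrow> real \<Rightarrow> ('i \<Rightarrow> 'a::real_inner) \<Rightarrow> ('i \<Rightarrow> 'a) \<Rightarrow> real" where
  "weighted_sum A h U X = (\<Sum>i\<in>A. half_sq (U i) powr (- 1 / h - 1) * (U i \<bullet> X i))"

text \<open>Derivative of \<open>weighted_sum A h U Y\<close> with respect to \<open>U\<close> in
  the direction \<open>X\<close>, with \<open>Y\<close> held fixed: the first summand differentiates
  the power, the second the inner product.\<close>

definition weighted_sum_deriv ::
  "'i set \<Rightarrow> real \<Rightarrow> ('i \<Rightarrow> 'a::real_inner) \<Rightarrow> ('i \<Rightarrow> 'a) \<Rightarrow> ('i \<Rightarrow> 'a) \<Rightarrow> real" where
  "weighted_sum_deriv A h U X Y =
     (\<Sum>i\<in>A. (- 1 / h - 1) * half_sq (U i) powr (- 1 / h - 2) * ((U i \<bullet> X i) * (U i \<bullet> Y i))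
       + half_sq (U i) powr (- 1 / h - 1) * (X i \<bullet> Y i))"

text \<open>First and second derivative of \<open>soft_dist\<close> at \<open>U\<close>, in the directions \<open>X\<close> and \<open>Y\<close>. The factors
  \<open>- h\<close> and \<open>- 1 / h\<close> from the two power laws cancel in the first. As the second is symmetric and
  bilinear, spatial, mixed and temporal partial derivatives of \<open>D_O\<close> are all instances of it, with
  velocities \<open>w\<close> (space) and \<open>- ddt (ob i)\<close> (time).\<close>

definition soft_dist_deriv :: "'i set \<Rightarrow> real \<Rightarrow> ('i \<Rightarrow> 'a::real_inner) \<Rightarrow> ('i \<Rightarrow> 'a) \<Rightarrow> real" where
  "soft_dist_deriv A h U X = power_sum A h U powr (- h - 1) * weighted_sum A h U X"

definition soft_dist_deriv2 ::
  "'i set \<Rightarrow> real \<Rightarrow> ('i \<Rightarrow> 'a::real_inner) \<Rightarrow> ('i \<Rightarrow> 'a) \<Rightarrow> ('i \<Rightarrow> 'a) \<Rightarrow> real" where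
  "soft_dist_deriv2 A h U X Y =
     (1 + 1 / h) * power_sum A h U powr (- h - 2) * (weighted_sum A h U X * weighted_sum A h U Y)
     + power_sum A h U powr (- h - 1) * weighted_sum_deriv A h U X Y"

lemma half_sq_eq_0_iff [simp]: "half_sq u = 0 \<longleftrightarrow> u = 0"
  by (simp add: half_sq_def)

lemma half_sq_pos: "u \<noteq> 0 \<Longrightarrow> half_sq u > 0"
  by (simp add: half_sq_def)

lemma power_sum_pos:
  assumes "finite A" "A \<noteq> {}" "\<And>i. i \<in> A \<Longrightarrow> U i \<noteq> 0"
  shows "power_sum A h U > 0"
  unfolding power_sum_def using assms by (intro sum_pos) auto

text \<open>A sum of nonnegative terms dominates each of them, the outer power with exponent
  \<open>- h\<close> reverses the inequality, and the exponents \<open>- 1 / h\<close> and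
  \<open>- h\<close> cancel. This is how a bound on \<open>soft_dist\<close> becomes a bound on
  every single distance.\<close>

lemma soft_dist_le:
  assumes "finite A" "h > 0" "\<And>j. j \<in> A \<Longrightarrow> U j \<noteq> 0" "i \<in> A"
  shows "soft_dist A h U \<le> half_sq (U i)"
proof -
  have pos: "half_sq (U i) > 0"
    using assms half_sq_pos by blast
  have "half_sq (U i) powr (- 1 / h) \<le> power_sum A h U"
    unfolding power_sum_def using assms by (intro member_le_sum) auto
  then have "power_sum A h U powr (- h) \<le> (half_sq (U i) powr (- 1 / h)) powr (- h)"
    using pos assms by (intro powr_mono2') auto
  also have "\<dots> = half_sq (U i)"
    using pos assms by (simp add: powr_powr)
  finally show ?thesis by (simp add: soft_dist_def)
qed

lemma weighted_sum_add:
  "weighted_sum A h U (\<lambda>i. X i + Y i) = weighted_sum A h U X + weighted_sum A h U Y"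
  by (simp add: weighted_sum_def inner_add_right distrib_left sum.distrib)

lemma weighted_sum_scaleR:
  "weighted_sum A h U (\<lambda>i. r *\<^sub>R X i) = r * weighted_sum A h U X"
  by (simp add: weighted_sum_def sum_distrib_left mult.left_commute)

lemma weighted_sum_deriv_add:
  "weighted_sum_deriv A h U (\<lambda>i. X i + X' i) Y
     = weighted_sum_deriv A h U X Y + weighted_sum_deriv A h U X' Y"
  unfolding weighted_sum_deriv_def sum.distrib[symmetric]
  by (intro sum.cong refl)
    (simp only: inner_add_right inner_add_left distrib_left distrib_right add_ac)

lemma weighted_sum_deriv_scaleR:
  "weighted_sum_deriv A h U (\<lambda>i. r *\<^sub>R X i) Y = r * weighted_sum_deriv A h U X Y"
  unfolding weighted_sum_deriv_def sum_distrib_left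
  by (intro sum.cong refl)
    (simp only: inner_scaleR_right inner_scaleR_left distrib_left mult.assoc mult.left_commute[of _ r])

lemma weighted_sum_deriv_commute:
  "weighted_sum_deriv A h U X Y = weighted_sum_deriv A h U Y X"
  unfolding weighted_sum_deriv_def
  by (intro sum.cong refl) (simp only: mult.commute[of "U _ \<bullet> X _"] inner_commute[of "X _"])

lemma soft_dist_deriv_add:
  "soft_dist_deriv A h U (\<lambda>i. X i + Y i) = soft_dist_deriv A h U X + soft_dist_deriv A h U Y"
  by (simp add: soft_dist_deriv_def weighted_sum_add distrib_left)

lemma soft_dist_deriv_scaleR:
  "soft_dist_deriv A h U (\<lambda>i. r *\<^sub>R X i) = r * soft_dist_deriv A h U X"
  by (simp add: soft_dist_deriv_def weighted_sum_scaleR)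

lemma soft_dist_deriv_zero [simp]: "soft_dist_deriv A h U (\<lambda>i. 0) = 0"
  by (simp add: soft_dist_deriv_def weighted_sum_def)

lemma soft_dist_deriv2_add_left:
  "soft_dist_deriv2 A h U (\<lambda>i. X i + X' i) Y
     = soft_dist_deriv2 A h U X Y + soft_dist_deriv2 A h U X' Y"
  unfolding soft_dist_deriv2_def weighted_sum_add weighted_sum_deriv_add
  by (simp only: distrib_left distrib_right add_ac)

lemma soft_dist_deriv2_scaleR_left:
  "soft_dist_deriv2 A h U (\<lambda>i. r *\<^sub>R X i) Y = r * soft_dist_deriv2 A h U X Y"
  unfolding soft_dist_deriv2_def weighted_sum_scaleR weighted_sum_deriv_scaleR
  by (simp only: distrib_left mult.assoc mult.left_commute[of _ r])

lemma soft_dist_deriv2_commute: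
  "soft_dist_deriv2 A h U X Y = soft_dist_deriv2 A h U Y X"
  unfolding soft_dist_deriv2_def weighted_sum_deriv_commute[of A h U X Y]
  by (simp only: mult.commute[of "weighted_sum A h U X"])

lemma soft_dist_deriv2_add_right:
  "soft_dist_deriv2 A h U X (\<lambda>i. Y i + Y' i)
     = soft_dist_deriv2 A h U X Y + soft_dist_deriv2 A h U X Y'"
  unfolding soft_dist_deriv2_commute[of A h U X] by (rule soft_dist_deriv2_add_left)

section \<open>Frechet derivatives of the smooth minimum\<close>

lemma has_derivative_powr_const:
  fixes f :: "'a::real_normed_vector \<Rightarrow> real"
  assumes "(f has_derivative f') (at x within S)" "f x > 0"
  shows "((\<lambda>x. f x powr c) has_derivative (\<lambda>d. c * f x powr (c - 1) * f' d)) (at x within S)"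
proof -
  have "((\<lambda>y. y powr c) has_field_derivative c * f x powr (c - 1)) (at (f x))"
    using assms(2) by (auto intro!: derivative_eq_intros simp: powr_diff)
  from has_derivative_compose[OF assms(1) this[unfolded has_field_derivative_def]]
  show ?thesis by simp
qed

text \<open>The parameter \<open>y\<close> of the family \<open>U y\<close> ranges over an arbitrary
  normed space, so that the same rules serve for derivatives in space and for one-sided derivatives
  in time.\<close>

context
  fixes A :: "'i set" and h :: real and U :: "'x::real_normed_vector \<Rightarrow> 'i \<Rightarrow> 'a::real_inner"
    and U' :: "'x \<Rightarrow> 'i \<Rightarrow> 'a" and x S
  assumes A: "finite A" "A \<noteq> {}" and h: "h > 0"
    and U: "\<And>i. i \<in> A \<Longrightarrow> ((\<lambda>y. U y i) has_derivative (\<lambda>d. U' d i)) (at x within S)"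
    and nz: "\<And>i. i \<in> A \<Longrightarrow> U x i \<noteq> 0"
begin

lemma has_derivative_half_sq_powr:
  assumes "i \<in> A"
  shows "((\<lambda>y. half_sq (U y i) powr c) has_derivative
           (\<lambda>d. c * half_sq (U x i) powr (c - 1) * (U x i \<bullet> U' d i))) (at x within S)"
proof -
  have "((\<lambda>y. half_sq (U y i)) has_derivative (\<lambda>d. U x i \<bullet> U' d i)) (at x within S)"
    unfolding half_sq_def power2_norm_eq_inner
    by (auto intro!: derivative_eq_intros U[OF assms] simp: inner_commute)
  from has_derivative_powr_const[OF this half_sq_pos[OF nz[OF assms]]] show ?thesis .
qed

lemma has_derivative_power_sum_powr:
  "((\<lambda>y. power_sum A h (U y) powr c) has_derivative
      (\<lambda>d. c * power_sum A h (U x) powr (c - 1)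
        * (- 1 / h * weighted_sum A h (U x) (U' d)))) (at x within S)"
proof -
  have "((\<lambda>y. power_sum A h (U y)) has_derivative
      (\<lambda>d. - 1 / h * weighted_sum A h (U x) (U' d))) (at x within S)"
    unfolding power_sum_def weighted_sum_def sum_distrib_left mult.assoc[symmetric]
    by (intro has_derivative_sum has_derivative_half_sq_powr)
  moreover have "power_sum A h (U x) > 0"
    using A nz by (rule power_sum_pos)
  ultimately show ?thesis by (rule has_derivative_powr_const)
qed

lemma has_derivative_soft_dist:
  "((\<lambda>y. soft_dist A h (U y)) has_derivative (\<lambda>d. soft_dist_deriv A h (U x) (U' d))) (at x within S)"
  using has_derivative_power_sum_powr[of "- h"] h unfolding soft_dist_def soft_dist_deriv_def
  by simp

text \<open>The direction \<open>Z\<close> may vary together with \<open>U\<close>, which produces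
  the second summand. Along a trajectory \<open>Z\<close> is the relative velocity, and that summand
  carries the accelerations.\<close>

lemma has_derivative_soft_dist_deriv:
  assumes Z: "\<And>i. i \<in> A \<Longrightarrow> ((\<lambda>y. Z y i) has_derivative (\<lambda>d. Z' d i)) (at x within S)"
  shows "((\<lambda>y. soft_dist_deriv A h (U y) (Z y)) has_derivative
      (\<lambda>d. soft_dist_deriv2 A h (U x) (U' d) (Z x) + soft_dist_deriv A h (U x) (Z' d))) (at x within S)"
proof -
  have sum: "((\<lambda>y. weighted_sum A h (U y) (Z y)) has_derivative
      (\<lambda>d. weighted_sum_deriv A h (U x) (U' d) (Z x) + weighted_sum A h (U x) (Z' d))) (at x within S)"
    unfolding weighted_sum_def weighted_sum_deriv_def sum.distrib[symmetric]
  proof (rule has_derivative_sum)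
    have e: "- 1 / h - 1 - 1 = - 1 / h - 2"
      by simp
    fix i assume i: "i \<in> A"
    show "((\<lambda>y. half_sq (U y i) powr (- 1 / h - 1) * (U y i \<bullet> Z y i)) has_derivative
      (\<lambda>d. (- 1 / h - 1) * half_sq (U x i) powr (- 1 / h - 2) * ((U x i \<bullet> U' d i) * (U x i \<bullet> Z x i))
            + half_sq (U x i) powr (- 1 / h - 1) * (U' d i \<bullet> Z x i)
            + half_sq (U x i) powr (- 1 / h - 1) * (U x i \<bullet> Z' d i))) (at x within S)"
      by (rule has_derivative_eq_rhs[OF has_derivative_mult
            [OF has_derivative_half_sq_powr[OF i] has_derivative_inner[OF U[OF i] Z[OF i]]]])
        (simp only: e fun_eq_iff distrib_left mult.assoc add_ac, simp)
  qed
  \<comment> \<open>Here \<open>w'\<close> and \<open>w\<close> are the powers of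
    \<open>power_sum\<close> with exponents \<open>- h - 1\<close> and \<open>- h - 2\<close>. The
    chain rule factors \<open>- h - 1\<close> and \<open>- 1 / h\<close> multiply to
    \<open>1 + 1 / h\<close>.\<close>
  have coeff: "w' * (q + s'') + (- h - 1) * w * (- 1 / h * s) * s'
      = (1 + 1 / h) * w * (s * s') + w' * q + w' * s''" for w w' q s s' s'' :: real
    using h by (simp add: field_simps)
  have "- h - 1 - 1 = - h - 2"
    by simp
  then show ?thesis
    unfolding soft_dist_deriv_def soft_dist_deriv2_def
    by (intro has_derivative_eq_rhs[OF has_derivative_mult[OF has_derivative_power_sum_powr sum]] ext)
      (simp only: coeff)
qed

end

section \<open>One-sided time derivatives and differential inequalities\<close>

lemma at_within_atLeast_neq_bot: "0 \<le> t \<Longrightarrow> at t within {0::real..} \<noteq> bot"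
  using islimpt_subset[of t "{t..t + 1}" "{0..}"] by (simp add: trivial_limit_within islimpt_Icc)

text \<open>A derivative within \<open>{0..}\<close> is unique, also at the end point 0, because
  every point of the half-line is a limit point of it.\<close>

lemma ddt_eqI:
  assumes "0 \<le> t" "(f has_vector_derivative d) (at t within {0..})"
  shows "ddt f t = d"
  using assms by (intro vector_derivative_within at_within_atLeast_neq_bot)

text \<open>Local agreement suffices. This matters for a frozen point, which an obstacle may hit at
  other times, so that the derivative formulas hold only near \<open>t\<close>.\<close>

lemma has_vector_derivative_transform_eventually:
  assumes "(f has_vector_derivative d) (at t within S)" "\<forall>\<^sub>F \<tau> in at t within S. f \<tau> = g \<tau>"
    and "f t = g t" "t \<in> S"
  shows "(g has_vector_derivative d) (at t within S)"
  using assms unfolding has_vector_derivative_def by (rule has_derivative_transform_eventually)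

text \<open>The function \<open>exp (- r * t) * y t\<close> has the derivative
  \<open>exp (- r * t) * (y' t - r * y t)\<close>, which is nonnegative. By the mean value theorem
  it stays above its initial value.\<close>

lemma nonneg_of_linear_differential_inequality:
  fixes y y' :: "real \<Rightarrow> real"
  assumes deriv: "\<And>t. 0 \<le> t \<Longrightarrow> (y has_real_derivative y' t) (at t within {0..})"
    and ge: "\<And>t. 0 \<le> t \<Longrightarrow> y' t \<ge> r * y t"
    and init: "y 0 \<ge> 0" and t: "0 \<le> t"
  shows "y t \<ge> 0"
proof -
  let ?z = "\<lambda>t. exp (- r * t) * y t" and ?z' = "\<lambda>t. exp (- r * t) * (y' t - r * y t)"
  have "(?z has_real_derivative ?z' s) (at s within {0..t})" if "0 \<le> s" for s
  proof (rule DERIV_subset)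
    show "(?z has_real_derivative ?z' s) (at s within {0..})"
      using deriv[OF that] by (auto intro!: derivative_eq_intros simp: algebra_simps)
  qed auto
  then have "\<exists>s\<in>{0..t}. ?z t - ?z 0 = ?z' s * (t - 0)"
    by (intro mvt_very_simple[OF t, of ?z "\<lambda>s. (*) (?z' s)"])
      (simp add: has_field_derivative_def)
  then obtain s where s: "s \<in> {0..t}" "?z t - ?z 0 = ?z' s * (t - 0)"
    by blast
  have "?z' s * (t - 0) \<ge> 0"
    using s(1) ge[of s] t by simp
  with s(2) init have "?z t \<ge> 0"
    by simp
  then show ?thesis
    by (simp add: zero_le_mult_iff)
qed

text \<open>For \<open>y = b' - r * b\<close> the hypothesis reads
  \<open>y' \<ge> (- \<alpha> - r) * y\<close>, so the first-order lemma gives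
  \<open>b' \<ge> r * b\<close>. A second application, now with rate \<open>r\<close>, gives the
  claim.\<close>

lemma nonneg_of_second_order_differential_inequality:
  fixes b b' b'' :: "real \<Rightarrow> real"
  assumes b: "\<And>t. 0 \<le> t \<Longrightarrow> (b has_real_derivative b' t) (at t within {0..})"
    and b': "\<And>t. 0 \<le> t \<Longrightarrow> (b' has_real_derivative b'' t) (at t within {0..})"
    and ge: "\<And>t. 0 \<le> t \<Longrightarrow> b'' t + \<alpha> * b' t + \<beta> * b t \<ge> 0"
    and root: "r\<^sup>2 + \<alpha> * r + \<beta> = 0"
    and init: "b 0 \<ge> 0" "b' 0 \<ge> r * b 0" and t: "0 \<le> t"
  shows "b t \<ge> 0"
proof -
  have "b' s - r * b s \<ge> 0" if s: "0 \<le> s" for s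
  proof (rule nonneg_of_linear_differential_inequality[where y = "\<lambda>s. b' s - r * b s"
        and y' = "\<lambda>s. b'' s - r * b' s" and r = "- \<alpha> - r"])
    show "((\<lambda>s. b' s - r * b s) has_real_derivative b'' u - r * b' u) (at u within {0..})"
      if "0 \<le> u" for u
      using DERIV_diff[OF b'[OF that] DERIV_cmult[OF b[OF that]]] by simp
    \<comment> \<open>By Vieta the other root is \<open>- \<alpha> - r\<close>, and \<beta> is the
      product of the two.\<close>
    have \<beta>: "\<beta> = r * (- \<alpha> - r)"
      using root by (simp add: power2_eq_square algebra_simps)
    show "b'' u - r * b' u \<ge> (- \<alpha> - r) * (b' u - r * b u)" if "0 \<le> u" for u
      using ge[OF that] unfolding \<beta> by (simp add: algebra_simps)
  qed (use init s in auto)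
  then show ?thesis
    using nonneg_of_linear_differential_inequality[of b b' r, OF b _ init(1) t] by simp
qed

text \<open>\<open>Min\<close> yields a member only of a finite nonempty set. The bound on
  \<open>k1\<close> makes the discriminant nonnegative, so the quadratic splits over the reals and
  its roots can be listed.\<close>

lemma Min_quadratic_root:
  fixes k1 k2 :: real
  assumes "k2 > 0" "k1 > 2 * sqrt k2" and r: "r = Min {r. r\<^sup>2 + k1 * r + k2 = 0}"
  shows "r\<^sup>2 + k1 * r + k2 = 0"
proof -
  define s where "s = sqrt (k1\<^sup>2 - 4 * k2)"
  have "(2 * sqrt k2)\<^sup>2 \<le> k1\<^sup>2"
    using assms by (intro power_mono) auto
  then have s: "s\<^sup>2 = k1\<^sup>2 - 4 * k2"
    using assms by (simp add: s_def power_mult_distrib)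
  have "(x - (- k1 + s) / 2) * (x - (- k1 - s) / 2) = x\<^sup>2 + k1 * x + (k1\<^sup>2 - s\<^sup>2) / 4" for x
    by (simp add: power2_eq_square field_simps)
  then have "x\<^sup>2 + k1 * x + k2 = (x - (- k1 + s) / 2) * (x - (- k1 - s) / 2)" for x
    using s by simp
  then have "{r. r\<^sup>2 + k1 * r + k2 = 0} = {(- k1 + s) / 2, (- k1 - s) / 2}"
    by (simp add: set_eq_iff del: mult_minus_left)
  then have "r \<in> {r. r\<^sup>2 + k1 * r + k2 = 0}"
    unfolding r by (intro Min_in) auto
  then show ?thesis by simp
qed

text \<open>Moving \<open>M\<close> to the other side of the inner product shows that the number
  equals its own negative.\<close>

lemma skew_orthogonal:
  fixes M :: "real^'n^'n"
  assumes "transpose M = - M"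
  shows "x \<bullet> (M *v x) = 0"
proof -
  have "x \<bullet> (M *v x) = (transpose M *v x) \<bullet> x"
    by (simp add: dot_lmul_matrix[symmetric])
  also have "\<dots> = - (x \<bullet> (M *v x))"
    by (simp add: assms inner_commute matrix_vector_mult_def inner_vec_def sum_negf)
  finally show ?thesis by simp
qed

section \<open>Partial derivatives of \<open>D_O\<close>\<close>

lemma D_O_eq: "D_O N ob h x t = soft_dist {1..N} h (\<lambda>i. x - ob i t)"
  by (simp add: D_O_def soft_dist_def power_sum_def half_sq_def)

context
  fixes N :: nat and ob :: "nat \<Rightarrow> real \<Rightarrow> real^'n" and h :: real
  assumes N: "N \<ge> 1" and h: "h > 0"
    and ob1: "\<And>i t. i \<in> {1..N} \<Longrightarrow> 0 \<le> t \<Longrightarrow> ob i differentiable (at t within {0..})"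
    and ob2: "\<And>i t. i \<in> {1..N} \<Longrightarrow> 0 \<le> t \<Longrightarrow>
      (\<lambda>\<tau>. ddt (ob i) \<tau>) differentiable (at t within {0..})"
begin

abbreviation (input) "vob i t \<equiv> ddt (ob i) t"
abbreviation (input) "aob i t \<equiv> ddt (ddt (ob i)) t"
abbreviation (input) "free x t \<equiv> \<forall>i\<in>{1..N}. x \<noteq> ob i t"

lemma vob: "i \<in> {1..N} \<Longrightarrow> 0 \<le> t \<Longrightarrow> (ob i has_vector_derivative vob i t) (at t within {0..})"
  using ob1 vector_derivative_works by blast

lemma aob: "i \<in> {1..N} \<Longrightarrow> 0 \<le> t \<Longrightarrow> (vob i has_vector_derivative aob i t) (at t within {0..})"
  using ob2 vector_derivative_works by blast

lemma has_derivative_soft_dist_deriv_space: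
  assumes "free x t"
  shows "((\<lambda>y. soft_dist_deriv {1..N} h (\<lambda>i. y - ob i t) Z) has_derivative
      (\<lambda>d. soft_dist_deriv2 {1..N} h (\<lambda>i. x - ob i t) (\<lambda>_. d) Z)) (at x)"
proof -
  have "((\<lambda>y. y - ob i t) has_derivative (\<lambda>d. d)) (at x)" for i
    by (auto intro!: derivative_eq_intros)
  from has_derivative_soft_dist_deriv[OF _ _ h this, where A = "{1..N}" and Z = "\<lambda>_. Z" and Z' = "\<lambda>_ _. 0"]
  show ?thesis
    using N assms by simp
qed

text \<open>A constant \<open>q\<close> gives partial time derivatives at a frozen point, and
  \<open>q = p\<close> gives the total derivative along the trajectory.\<close>

lemma has_vector_derivative_soft_dist:
  assumes "0 \<le> t" "free (q t) t" "(q has_vector_derivative w) (at t within {0..})"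
  shows "((\<lambda>\<tau>. soft_dist {1..N} h (\<lambda>i. q \<tau> - ob i \<tau>)) has_vector_derivative
      soft_dist_deriv {1..N} h (\<lambda>i. q t - ob i t) (\<lambda>i. w - vob i t)) (at t within {0..})"
proof -
  have "((\<lambda>\<tau>. q \<tau> - ob i \<tau>) has_derivative (\<lambda>d. d *\<^sub>R (w - vob i t))) (at t within {0..})"
    if "i \<in> {1..N}" for i
    using has_vector_derivative_diff[OF assms(3) vob[OF that assms(1)]]
    by (simp add: has_vector_derivative_def)
  from has_derivative_soft_dist[OF _ _ h this, where A = "{1..N}"]
  show ?thesis
    unfolding has_vector_derivative_def using N assms(2) by (simp add: soft_dist_deriv_scaleR)
qed

lemma has_vector_derivative_soft_dist_deriv:
  assumes "0 \<le> t" "free (q t) t" "(q has_vector_derivative w) (at t within {0..})"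
    and Z: "\<And>i. i \<in> {1..N} \<Longrightarrow> (Z i has_vector_derivative Z' i) (at t within {0..})"
  shows "((\<lambda>\<tau>. soft_dist_deriv {1..N} h (\<lambda>i. q \<tau> - ob i \<tau>) (\<lambda>i. Z i \<tau>)) has_vector_derivative
      soft_dist_deriv2 {1..N} h (\<lambda>i. q t - ob i t) (\<lambda>i. w - vob i t) (\<lambda>i. Z i t)
      + soft_dist_deriv {1..N} h (\<lambda>i. q t - ob i t) Z') (at t within {0..})"
proof -
  have "((\<lambda>\<tau>. q \<tau> - ob i \<tau>) has_derivative (\<lambda>d. d *\<^sub>R (w - vob i t))) (at t within {0..})"
    if "i \<in> {1..N}" for i
    using has_vector_derivative_diff[OF assms(3) vob[OF that assms(1)]]
    by (simp add: has_vector_derivative_def)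
  from has_derivative_soft_dist_deriv[OF _ _ h this, where A = "{1..N}"
      and Z = "\<lambda>t i. Z i t" and Z' = "\<lambda>d i. d *\<^sub>R Z' i"]
  show ?thesis
    unfolding has_vector_derivative_def using N assms(2) Z[unfolded has_vector_derivative_def]
    by (simp add: soft_dist_deriv_scaleR soft_dist_deriv2_scaleR_left distrib_left)
qed

text \<open>The gradient is handled only through its inner products, which are directional
  derivatives with all difference vectors displaced by the same \<open>w\<close>.\<close>

lemma inner_grad_D_O:
  assumes "free x t"
  shows "grad_D_O N ob h x t \<bullet> w = soft_dist_deriv {1..N} h (\<lambda>i. x - ob i t) (\<lambda>_. w)"
proof -
  let ?U = "\<lambda>i. x - ob i t"
  \<comment> \<open>Riesz representative of the derivative functional: the common direction is
    pulled out of the sum.\<close>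
  define g where "g = power_sum {1..N} h ?U powr (- h - 1) *\<^sub>R
    (\<Sum>i\<in>{1..N}. half_sq (?U i) powr (- 1 / h - 1) *\<^sub>R ?U i)"
  have g: "g \<bullet> d = soft_dist_deriv {1..N} h ?U (\<lambda>_. d)" for d
    by (simp add: g_def soft_dist_deriv_def weighted_sum_def inner_sum_left)
  have "((\<lambda>y. y - ob i t) has_derivative (\<lambda>d. d)) (at x)" for i
    by (auto intro!: derivative_eq_intros)
  from has_derivative_soft_dist[where A = "{1..N}" and U = "\<lambda>y i. y - ob i t" and U' = "\<lambda>d _. d", OF _ _ h this]
  have "GDERIV (\<lambda>y. D_O N ob h y t) x :> g"
    using N assms by (simp add: gderiv_def D_O_eq g[symmetric] inner_commute del: One_nat_def)
  then show ?thesis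
    unfolding grad_D_O_def by (subst gradient_eqI) (auto simp: g)
qed

lemma ddt_D_O:
  assumes "0 \<le> t" "free x t"
  shows "ddt (\<lambda>\<tau>. D_O N ob h x \<tau>) t = soft_dist_deriv {1..N} h (\<lambda>i. x - ob i t) (\<lambda>i. - vob i t)"
  using has_vector_derivative_soft_dist[of t "\<lambda>_. x" 0] assms
  by (intro ddt_eqI) (simp_all add: D_O_eq)

text \<open>By linearity, the spatial direction \<open>w\<close> and the temporal direction
  \<open>- vob i\<close> merge into the relative velocity.\<close>

lemma B_dot_eq:
  assumes "0 \<le> t" "free x t"
  shows "B_dot N ob h x w t = soft_dist_deriv {1..N} h (\<lambda>i. x - ob i t) (\<lambda>i. w - vob i t)"
  using soft_dist_deriv_add[of _ _ _ "\<lambda>_. w" "\<lambda>i. - vob i t"]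
  by (simp add: B_dot_def ddt_D_O[OF assms] inner_grad_D_O[OF assms(2)])

lemma eventually_free_space:
  assumes "free x t"
  shows "\<forall>\<^sub>F y in at x. free y t"
  using assms by (intro eventually_ball_finite) (auto intro: eventually_neq_at_within)

text \<open>The finitely many obstacles move continuously, so a free point stays free for nearby
  times.\<close>

lemma eventually_free_time:
  assumes "0 \<le> t" "free x t"
  shows "\<forall>\<^sub>F \<tau> in at t within {0..}. 0 \<le> \<tau> \<and> free x \<tau>"
proof -
  have "\<forall>\<^sub>F \<tau> in at t within {0..}. x \<noteq> ob i \<tau>" if "i \<in> {1..N}" for i
  proof -
    have "(ob i \<longlongrightarrow> ob i t) (at t within {0..})"
      using differentiable_imp_continuous_within[OF ob1[OF that assms(1)]]
      by (simp add: continuous_within)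
    then show ?thesis
      using assms(2) that tendsto_imp_eventually_ne[of "ob i" "ob i t" _ x]
      by (auto simp: eq_commute[of x])
  qed
  moreover have "\<forall>\<^sub>F \<tau> in at t within {0..}. 0 \<le> \<tau>"
    by (simp add: eventually_at_filter)
  ultimately show ?thesis
    by (intro eventually_conj eventually_ball_finite) auto
qed

text \<open>Each function \<open>grad_D_O N ob h y t \<bullet> b\<close> agrees with
  \<open>soft_dist_deriv\<close> near \<open>x\<close>, hence is differentiable. Taking basis
  vectors for \<open>b\<close>, the gradient itself is differentiable, and uniqueness of derivatives
  identifies its Jacobian.\<close>

lemma inner_jacobian_grad_D_O:
  assumes "free x t"
  shows "w \<bullet> (jacobian (\<lambda>y. grad_D_O N ob h y t) (at x) *v d)
    = soft_dist_deriv2 {1..N} h (\<lambda>i. x - ob i t) (\<lambda>_. d) (\<lambda>_. w)"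
proof -
  have deriv: "((\<lambda>y. grad_D_O N ob h y t \<bullet> b) has_derivative
      (\<lambda>d. soft_dist_deriv2 {1..N} h (\<lambda>i. x - ob i t) (\<lambda>_. d) (\<lambda>_. b))) (at x)" for b
    using assms eventually_free_space[OF assms]
    by (intro has_derivative_transform_eventually[OF has_derivative_soft_dist_deriv_space])
      (auto elim!: eventually_mono simp: inner_grad_D_O)
  then have "(\<lambda>y. grad_D_O N ob h y t) differentiable (at x)"
    by (subst differentiable_componentwise_within) (auto simp: differentiable_def)
  then have "((\<lambda>y. grad_D_O N ob h y t \<bullet> w) has_derivative
      (\<lambda>d. (jacobian (\<lambda>y. grad_D_O N ob h y t) (at x) *v d) \<bullet> w)) (at x)"
    unfolding jacobian_works by (rule has_derivative_inner_left)
  from has_derivative_unique[OF this deriv] show ?thesis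
    by (metis inner_commute)
qed

lemma inner_ddt_grad_D_O:
  assumes "0 \<le> t" "free x t"
  shows "ddt (\<lambda>\<tau>. grad_D_O N ob h x \<tau>) t \<bullet> w
    = soft_dist_deriv2 {1..N} h (\<lambda>i. x - ob i t) (\<lambda>i. - vob i t) (\<lambda>_. w)"
proof -
  have deriv: "((\<lambda>\<tau>. grad_D_O N ob h x \<tau> \<bullet> b) has_vector_derivative
      soft_dist_deriv2 {1..N} h (\<lambda>i. x - ob i t) (\<lambda>i. - vob i t) (\<lambda>_. b)) (at t within {0..})" for b
  proof (rule has_vector_derivative_transform_eventually)
    show "((\<lambda>\<tau>. soft_dist_deriv {1..N} h (\<lambda>i. x - ob i \<tau>) (\<lambda>_. b)) has_vector_derivative
      soft_dist_deriv2 {1..N} h (\<lambda>i. x - ob i t) (\<lambda>i. - vob i t) (\<lambda>_. b)) (at t within {0..})"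
      using has_vector_derivative_soft_dist_deriv[of t "\<lambda>_. x" 0 "\<lambda>_ _. b" "\<lambda>_. 0"] assms
      by simp
  qed (use assms eventually_free_time[OF assms] in \<open>auto elim!: eventually_mono simp: inner_grad_D_O\<close>)
  then have "(\<lambda>\<tau>. grad_D_O N ob h x \<tau>) differentiable (at t within {0..})"
    by (subst differentiable_componentwise_within)
      (auto simp: differentiable_def has_vector_derivative_def)
  then have "((\<lambda>\<tau>. grad_D_O N ob h x \<tau> \<bullet> w) has_vector_derivative
      ddt (\<lambda>\<tau>. grad_D_O N ob h x \<tau>) t \<bullet> w) (at t within {0..})"
    unfolding vector_derivative_works
    by (rule bounded_linear.has_vector_derivative[OF bounded_linear_inner_left])
  from ddt_eqI[OF assms(1) this] ddt_eqI[OF assms(1) deriv] show ?thesis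
    by simp
qed

text \<open>The inner derivative is given by \<open>ddt_D_O\<close> for all times near
  \<open>t\<close>. The direction \<open>- vob i\<close> is itself time-dependent, whence the term
  with the obstacle accelerations.\<close>

lemma ddt_ddt_D_O:
  assumes "0 \<le> t" "free x t"
  shows "ddt (\<lambda>\<tau>. ddt (\<lambda>\<tau>'. D_O N ob h x \<tau>') \<tau>) t
    = soft_dist_deriv2 {1..N} h (\<lambda>i. x - ob i t) (\<lambda>i. - vob i t) (\<lambda>i. - vob i t)
      + soft_dist_deriv {1..N} h (\<lambda>i. x - ob i t) (\<lambda>i. - aob i t)" (is "_ = ?r")
proof (rule ddt_eqI[OF assms(1)], rule has_vector_derivative_transform_eventually)
  show "((\<lambda>\<tau>. soft_dist_deriv {1..N} h (\<lambda>i. x - ob i \<tau>) (\<lambda>i. - vob i \<tau>))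
      has_vector_derivative ?r) (at t within {0..})"
    using has_vector_derivative_soft_dist_deriv[of t "\<lambda>_. x" 0 "\<lambda>i \<tau>. - vob i \<tau>" "\<lambda>i. - aob i t"]
      assms aob
    by (simp add: has_vector_derivative_minus)
qed (use assms eventually_free_time[OF assms] in \<open>auto elim!: eventually_mono simp: ddt_D_O\<close>)

text \<open>The spatial, mixed and temporal second-order terms are the expansion of one quadratic
  form at \<open>w - vob i\<close>; the factor 2 reflects its symmetry.\<close>

lemma F1_eq:
  assumes "0 \<le> t" "free x t"
  shows "F1 N ob h lam k1 k2 x w t =
    soft_dist_deriv2 {1..N} h (\<lambda>i. x - ob i t) (\<lambda>i. w - vob i t) (\<lambda>i. w - vob i t)
    + soft_dist_deriv {1..N} h (\<lambda>i. x - ob i t) (\<lambda>i. - aob i t)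
    + k1 * B_dot N ob h x w t + k2 * B_O N ob h lam x t"
proof -
  let ?Q = "soft_dist_deriv2 {1..N} h (\<lambda>i. x - ob i t)"
  have "?Q (\<lambda>i. w + - vob i t) (\<lambda>i. w + - vob i t)
      = ?Q (\<lambda>_. w) (\<lambda>_. w) + 2 * ?Q (\<lambda>i. - vob i t) (\<lambda>_. w) + ?Q (\<lambda>i. - vob i t) (\<lambda>i. - vob i t)"
    unfolding soft_dist_deriv2_add_left soft_dist_deriv2_add_right
    using soft_dist_deriv2_commute[of _ _ _ "\<lambda>_. w" "\<lambda>i. - vob i t"] by simp
  then show ?thesis
    unfolding F1_def inner_jacobian_grad_D_O[OF assms(2)] inner_ddt_grad_D_O[OF assms]
      ddt_ddt_D_O[OF assms] by simp
qed

section \<open>The barrier function along a trajectory\<close>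

context
  fixes p v a :: "real \<Rightarrow> real^'n"
  assumes p: "\<And>t. 0 \<le> t \<Longrightarrow> (p has_vector_derivative v t) (at t within {0..})"
    and v: "\<And>t. 0 \<le> t \<Longrightarrow> (v has_vector_derivative a t) (at t within {0..})"
    and free: "\<And>t. 0 \<le> t \<Longrightarrow> free (p t) t"
begin

lemma B_O_has_derivative:
  assumes t: "0 \<le> t"
  shows "((\<lambda>\<tau>. B_O N ob h lam (p \<tau>) \<tau>) has_real_derivative B_dot N ob h (p t) (v t) t) (at t within {0..})"
  using has_vector_derivative_soft_dist[OF t free[OF t] p[OF t]]
  unfolding B_O_def D_O_eq B_dot_eq[OF t free[OF t]] has_real_derivative_iff_has_vector_derivative[symmetric]
  by (auto intro!: derivative_eq_intros)

text \<open>In the second total derivative of \<open>B_O\<close>, the relative acceleration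
  \<open>a - aob i\<close> splits by linearity: the part with \<open>a\<close> is the inner product
  with the gradient, the rest is already in \<open>F1\<close>. Subtracting the terms with
  \<open>k1\<close> and \<open>k2\<close> undoes their inclusion in \<open>F1\<close>.\<close>

lemma B_dot_has_derivative:
  assumes t: "0 \<le> t"
  shows "((\<lambda>\<tau>. B_dot N ob h (p \<tau>) (v \<tau>) \<tau>) has_real_derivative
      F1 N ob h lam k1 k2 (p t) (v t) t + grad_D_O N ob h (p t) t \<bullet> a t
      - k1 * B_dot N ob h (p t) (v t) t - k2 * B_O N ob h lam (p t) t) (at t within {0..})"
    (is "(_ has_real_derivative ?r) _")
proof -
  have "((\<lambda>\<tau>. soft_dist_deriv {1..N} h (\<lambda>i. p \<tau> - ob i \<tau>) (\<lambda>i. v \<tau> - vob i \<tau>)) has_vector_derivative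
      soft_dist_deriv2 {1..N} h (\<lambda>i. p t - ob i t) (\<lambda>i. v t - vob i t) (\<lambda>i. v t - vob i t)
      + soft_dist_deriv {1..N} h (\<lambda>i. p t - ob i t) (\<lambda>i. a t - aob i t)) (at t within {0..})"
    by (rule has_vector_derivative_soft_dist_deriv[OF t free[OF t] p[OF t]])
      (rule has_vector_derivative_diff[OF v[OF t] aob[OF _ t]])
  also have "soft_dist_deriv2 {1..N} h (\<lambda>i. p t - ob i t) (\<lambda>i. v t - vob i t) (\<lambda>i. v t - vob i t)
      + soft_dist_deriv {1..N} h (\<lambda>i. p t - ob i t) (\<lambda>i. a t - aob i t) = ?r"
    using soft_dist_deriv_add[of _ _ _ "\<lambda>_. a t" "\<lambda>i. - aob i t"]
    by (simp add: F1_eq[OF t free[OF t]] inner_grad_D_O[OF free[OF t]])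
  \<comment> \<open>The trajectory avoids the obstacles at all times, so the formula for
    \<open>B_dot\<close> holds on the whole half-line.\<close>
  finally show ?thesis
    unfolding has_real_derivative_iff_has_vector_derivative
    by (rule has_vector_derivative_transform[rotated 2]) (use t free in \<open>auto simp: B_dot_eq\<close>)
qed

end

end

section \<open>Effect of the blended control and the distance bound\<close>

lemma inner_a_Psi:
  assumes "transpose M = - M" "grad_D_O N ob h x t \<noteq> 0"
  shows "grad_D_O N ob h x t \<bullet> a_Psi N ob h lam k1 k2 M \<epsilon> x w t = - F1 N ob h lam k1 k2 x w t"
  unfolding a_Psi_def T_O_def
  using assms(2) skew_orthogonal[OF assms(1), of "grad_D_O N ob h x t"]
  by (simp only: inner_add_right inner_scaleR_right power2_norm_eq_inner) simp

text \<open>\<open>Theta\<close> clamps a positive multiple of the very number it is multiplied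
  with: it is 0 if that number is negative, and it is never negative itself.\<close>

lemma Theta_mult_nonneg: "k_E > 0 \<Longrightarrow> Theta k_E g a b * (g \<bullet> (a - b)) \<ge> 0"
  by (auto simp: Theta_def min_def max_def mult_le_0_iff zero_le_mult_iff)

theorem lemma2:
  fixes c :: "real \<Rightarrow> real \<Rightarrow> real^'n" and S :: "real set" and \<Omega> :: "((real^'n) \<times> real) set"
    and ob :: "nat \<Rightarrow> real \<Rightarrow> real^'n" and N :: nat and M :: "real^'n^'n"
    and k_G \<sigma> v_r k_p k_v h lam k1 k2 r1 \<epsilon> k_E :: real
    and p v a :: "real \<Rightarrow> real^'n"
  assumes gains: "k_G > 0" "\<sigma> \<in> {1, -1}" "v_r > 0" "k_p > 0" "k_v > 0" "k_E > 0"
      "h > 0" "lam > 0" "\<epsilon> > 0" "k2 > 0" "k1 > 2 * sqrt k2"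
    and r1: "r1 = Min {r. r\<^sup>2 + k1 * r + k2 = 0}"
    and curve_params: "is_interval S" "interior S \<noteq> {}"
    and domain: "openin (top_of_set (UNIV \<times> {0..})) \<Omega>" "\<forall>t\<ge>0. (p t, t) \<in> \<Omega>"
    and argmin_singleton:
      "\<forall>(x, t)\<in>\<Omega>. \<exists>!s. is_arg_min (\<lambda>s. norm (x - c s t)) (\<lambda>s. s \<in> S) s"
    and path_law_well_defined:
      "\<forall>t\<ge>0. (\<lambda>s. c s t) differentiable (at (s_star S c (p t) t) within S)"
      "\<forall>t\<ge>0. T_C S c (p t) t \<noteq> 0"
      "\<forall>t\<ge>0. (\<lambda>\<tau>. D_C S c (p t) \<tau>) differentiable (at t within {0..})"
      "\<forall>t\<ge>0. norm (Phi_T S c (p t) t) < v_r"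
      "\<forall>t\<ge>0. (\<lambda>\<tau>. Phi S c k_G \<sigma> v_r (p \<tau>) \<tau>) differentiable (at t within {0..})"
    and obstacles: "N \<ge> 1"
      "\<forall>i\<in>{1..N}. \<forall>t\<ge>0. ob i differentiable (at t within {0..})"
      "\<forall>i\<in>{1..N}. \<forall>t\<ge>0. (\<lambda>\<tau>. ddt (ob i) \<tau>) differentiable (at t within {0..})"
    and skew: "transpose M = - M"
    and M_choice: "\<forall>t\<ge>0. T_O N ob h M (p t) t \<bullet> v t > 0"
    and avoidance_law_well_defined:
      "\<forall>t\<ge>0. \<forall>i\<in>{1..N}. p t \<noteq> ob i t"
      "\<forall>t\<ge>0. grad_D_O N ob h (p t) t \<noteq> 0"
      "\<forall>t\<ge>0. T_O N ob h M (p t) t \<noteq> 0"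
    and dynamics:
      "\<forall>t\<ge>0. (p has_vector_derivative v t) (at t within {0..})"
      "\<forall>t\<ge>0. (v has_vector_derivative a t) (at t within {0..})"
    and control:
      "\<forall>t\<ge>0.
         (let a\<^sub>\<Phi> = a_Phi S c k_G \<sigma> v_r k_p k_v p v t;
              a\<^sub>\<Psi> = a_Psi N ob h lam k1 k2 M \<epsilon> (p t) (v t) t;
              \<Theta> = Theta k_E (grad_D_O N ob h (p t) t) a\<^sub>\<Phi> a\<^sub>\<Psi>
          in a t = \<Theta> *\<^sub>R a\<^sub>\<Phi> + (1 - \<Theta>) *\<^sub>R a\<^sub>\<Psi>)"
    and initial: "B_O N ob h lam (p 0) 0 \<ge> 0"
      "B_dot N ob h (p 0) (v 0) 0 \<ge> r1 * B_O N ob h lam (p 0) 0"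
  shows "\<forall>t\<ge>0. Min ((\<lambda>i. norm (p t - ob i t)) ` {1..N}) \<ge> lam"
proof (intro allI impI)
  have free: "\<forall>i\<in>{1..N}. p t \<noteq> ob i t" if "0 \<le> t" for t
    using avoidance_law_well_defined that by blast
  have ob: "ob i differentiable (at t within {0..})" "(\<lambda>\<tau>. ddt (ob i) \<tau>) differentiable (at t within {0..})"
    if "i \<in> {1..N}" "0 \<le> t" for i t
    using obstacles that by blast+
  have dyn: "(p has_vector_derivative v t) (at t within {0..})"
      "(v has_vector_derivative a t) (at t within {0..})" if "0 \<le> t" for t
    using dynamics that by blast+
  note traj = obstacles(1) gains(7) ob dyn free
  have F1_ge: "F1 N ob h lam k1 k2 (p t) (v t) t + grad_D_O N ob h (p t) t \<bullet> a t \<ge> 0"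
    if t: "0 \<le> t" for t
  proof -
    define g where "g = grad_D_O N ob h (p t) t"
    define a1 where "a1 = a_Phi S c k_G \<sigma> v_r k_p k_v p v t"
    define a2 where "a2 = a_Psi N ob h lam k1 k2 M \<epsilon> (p t) (v t) t"
    define \<theta> where "\<theta> = Theta k_E g a1 a2"
    \<comment> \<open>Written as a correction of the avoidance law, the control contributes
      \<open>- F1\<close> plus a nonnegative term in the gradient direction.\<close>
    have "a t = a2 + \<theta> *\<^sub>R (a1 - a2)"
      using control t by (simp add: Let_def a1_def a2_def \<theta>_def g_def algebra_simps)
    moreover have "g \<bullet> a2 = - F1 N ob h lam k1 k2 (p t) (v t) t"
      unfolding g_def a2_def using skew avoidance_law_well_defined(2) t by (intro inner_a_Psi) auto
    moreover have "\<theta> * (g \<bullet> (a1 - a2)) \<ge> 0"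
      unfolding \<theta>_def using gains by (intro Theta_mult_nonneg)
    ultimately show ?thesis
      by (simp add: inner_add_right flip: g_def)
  qed
  fix t :: real assume t: "0 \<le> t"
  have "B_O N ob h lam (p t) t \<ge> 0"
  proof (rule nonneg_of_second_order_differential_inequality[where b = "\<lambda>t. B_O N ob h lam (p t) t"])
    fix s :: real assume s: "0 \<le> s"
    show "((\<lambda>s. B_O N ob h lam (p s) s) has_real_derivative B_dot N ob h (p s) (v s) s)
        (at s within {0..})"
      by (rule B_O_has_derivative[OF traj s])
    show "((\<lambda>s. B_dot N ob h (p s) (v s) s) has_real_derivative
        F1 N ob h lam k1 k2 (p s) (v s) s + grad_D_O N ob h (p s) s \<bullet> a s
        - k1 * B_dot N ob h (p s) (v s) s - k2 * B_O N ob h lam (p s) s) (at s within {0..})"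
      by (rule B_dot_has_derivative[OF traj s])
    \<comment> \<open>Here \<alpha> and \<beta> are \<open>k1\<close> and \<open>k2\<close>: the
      damping and stiffness terms cancel, and \<open>F1_ge\<close> is what remains.\<close>
    show "F1 N ob h lam k1 k2 (p s) (v s) s + grad_D_O N ob h (p s) s \<bullet> a s
        - k1 * B_dot N ob h (p s) (v s) s - k2 * B_O N ob h lam (p s) s
        + k1 * B_dot N ob h (p s) (v s) s + k2 * B_O N ob h lam (p s) s \<ge> 0"
      using F1_ge[OF s] by simp
  next
    show "r1\<^sup>2 + k1 * r1 + k2 = 0"
      by (rule Min_quadratic_root[OF gains(10,11) r1])
  qed (use initial t in simp_all)
  then have D: "lam\<^sup>2 / 2 \<le> soft_dist {1..N} h (\<lambda>i. p t - ob i t)"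
    by (simp add: B_O_def D_O_eq)
  \<comment> \<open>The smooth minimum lies between half of \<open>lam\<close> squared and half of
    each squared distance; positivity of \<open>lam\<close> allows the squares to be
    dropped.\<close>
  have "lam \<le> norm (p t - ob i t)" if "i \<in> {1..N}" for i
  proof -
    have "soft_dist {1..N} h (\<lambda>i. p t - ob i t) \<le> half_sq (p t - ob i t)"
      using gains free[OF t] that by (intro soft_dist_le) auto
    with D have "lam\<^sup>2 \<le> (norm (p t - ob i t))\<^sup>2"
      by (simp add: half_sq_def)
    then show ?thesis
      using gains(8) by (simp add: power2_le_iff_abs_le)
  qed
  then show "Min ((\<lambda>i. norm (p t - ob i t)) ` {1..N}) \<ge> lam"
    using obstacles(1) by (subst Min_ge_iff) auto
qed

end
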